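(* Let $G$ be a regular graph with valency $k > 2$, and let $U = U(G)$ be the transition matrix of the discrete-time quantum walk on $G$. Then $$S^+(U^2) = \left(S^+(U)\right)^2 + I,$$ where $I$ is the identity matrix indexed by the arcs of $G$.
   Context: Graphs are finite, undirected and simple. The arcs of $G$ are the ordered pairs $uv$ with $u$ adjacent to $v$ (each edge gives two arcs). The transition matrix $U = U(G)$ has rows and columns indexed by the arcs of $G$, with entries $$U_{wx,uv} = \begin{cases} \frac{2}{d(v)} & \text{if } v = w \text{ and } u \neq x,\\ \frac{2}{d(v)} - 1 & \text{if } v = w \text{ and } u = x,\\ 0 & \text{otherwise,}\end{cases}$$ where $d(v)$ is the degree of $v$. For a real matrix $M$, the positive support $S^+(M)$ is the $0/1$-matrix of the same size with $(S^+(M))_{i,j} = 1$ if $M_{i,j} > 0$ and $0$ otherwise. *)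

theory Defs
  imports "Graph_Theory.Pair_Digraph" "Jordan_Normal_Form.Matrix"
begin

text \<open>
  A finite simple undirected graph is a \<^locale>\<open>pair_graph\<close>: every edge is represented by its two
  opposite arcs, so \<^term>\<open>parcs G\<close> is the set of ordered pairs of adjacent vertices, and the degree of
  a vertex is its out-degree (equivalently its in-degree).
\<close>

definition regular :: "'a pair_pre_digraph \<Rightarrow> nat \<Rightarrow> bool" where
  "regular G k \<longleftrightarrow> (\<forall>v \<in> pverts G. out_degree (with_proj G) v = k)"

fun transition_entry :: "'a pair_pre_digraph \<Rightarrow> 'a \<times> 'a \<Rightarrow> 'a \<times> 'a \<Rightarrow> real" where
  "transition_entry G (w, x) (u, v) =
    (if v = w \<and> u \<noteq> x then 2 / real (out_degree (with_proj G) v)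
     else if v = w \<and> u = x then 2 / real (out_degree (with_proj G) v) - 1
     else 0)"

text \<open>
  Library matrices are indexed by initial segments of the natural numbers, so matrices indexed by arcs
  are taken relative to an enumeration of the arcs: row and column \<open>i\<close> belong to the arc \<open>es ! i\<close>.
\<close>

definition arc_enumeration :: "'a pair_pre_digraph \<Rightarrow> ('a \<times> 'a) list \<Rightarrow> bool" where
  "arc_enumeration G es \<longleftrightarrow> distinct es \<and> set es = parcs G"

definition transition_mat :: "'a pair_pre_digraph \<Rightarrow> ('a \<times> 'a) list \<Rightarrow> real mat" where
  "transition_mat G es =
    mat (length es) (length es) (\<lambda>(i, j). transition_entry G (es ! i) (es ! j))"

definition positive_support :: "real mat \<Rightarrow> real mat" where
  "positive_support M = map_mat (\<lambda>x. if x > 0 then 1 else 0) M"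

end

theory Submission
  imports Defs
begin

text \<open>
  There is at most one walk of two arcs leading from \<open>uv\<close> to \<open>wx\<close>, through the arc \<open>vw\<close>, so an entry
  of \<open>U\<^sup>2\<close> is a single product \<open>U\<^bsub>wx,vw\<^esub> U\<^bsub>vw,uv\<^esub>\<close>. A factor is negative exactly when it is a
  backtracking step, as \<open>k > 2\<close>. Hence the product is positive iff both steps are non-backtracking,
  which is what \<open>S\<^sup>+(U)\<^sup>2\<close> counts, or both are backtracking, which means \<open>wx = uv\<close>.
\<close>

text \<open>Since \<open>nth es\<close> is a bijection from positions onto the listed elements, the
  enumeration drops out of the entries of a square. Keeping \<open>f\<close> general serves both
  \<open>U\<close> and its support.\<close>

lemma index_mat_pow_2:
  fixes f :: "'b \<Rightarrow> 'b \<Rightarrow> 'c :: comm_semiring_1"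
  assumes "distinct es" "i < length es" "j < length es"
  shows "(mat (length es) (length es) (\<lambda>(i, j). f (es ! i) (es ! j)) ^\<^sub>m 2) $$ (i, j) =
    (\<Sum>a\<in>set es. f (es ! i) a * f a (es ! j))"
proof -
  have "(\<Sum>a\<in>set es. f (es ! i) a * f a (es ! j)) =
      (\<Sum>l\<in>{..<length es}. f (es ! i) (es ! l) * f (es ! l) (es ! j))"
    using sum.reindex_bij_betw[OF bij_betw_nth[OF assms(1) refl refl],
        of "\<lambda>a. f (es ! i) a * f a (es ! j)"] by simp
  then show ?thesis
    using assms by (simp add: numeral_2_eq_2 scalar_prod_def lessThan_atLeast0)
qed

text \<open>A nonzero first factor forces the middle arc to end at \<open>w\<close>, a nonzero
  second one forces it to start at \<open>v\<close>.\<close>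

lemma sum_two_step_walks:
  fixes f :: "'a \<times> 'a \<Rightarrow> 'a \<times> 'a \<Rightarrow> 'c :: comm_semiring_1"
  assumes "finite A" and "\<And>w x u v. v \<noteq> w \<Longrightarrow> f (w, x) (u, v) = 0"
  shows "(\<Sum>a\<in>A. f (w, x) a * f a (u, v)) =
    (if (v, w) \<in> A then f (w, x) (v, w) * f (v, w) (u, v) else 0)"
proof -
  have "(\<Sum>a\<in>A. f (w, x) a * f a (u, v)) =
      (\<Sum>a\<in>A. if a = (v, w) then f (w, x) (v, w) * f (v, w) (u, v) else 0)"
    by (intro sum.cong refl) (use assms(2) in \<open>force split: prod.split\<close>)
  then show ?thesis
    using assms(1) by simp
qed

lemma transition_entry_regular:
  assumes "pair_graph G" "regular G k" "(w, x) \<in> parcs G"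
  shows "transition_entry G (w, x) (u, v) =
    (if v = w then if u = x then 2 / real k - 1 else 2 / real k else 0)"
proof -
  interpret pair_graph G by fact
  have "w \<in> pverts G"
    using assms(3) in_arcsD1 by blast
  then show ?thesis
    using assms(2) by (simp add: regular_def)
qed

theorem theorem4p1:
  fixes G :: "'a pair_pre_digraph" and k :: nat and es :: "('a \<times> 'a) list"
  assumes "pair_graph G"
    and "regular G k"
    and "k > 2"
    and "arc_enumeration G es"
  shows "positive_support (transition_mat G es ^\<^sub>m 2) =
    positive_support (transition_mat G es) ^\<^sub>m 2 + 1\<^sub>m (length es)"
proof -
  interpret pair_graph G by fact
  let ?n = "length es"
  let ?U = "transition_entry G"
  define S where "S a b = (if ?U a b > 0 then 1 else 0 :: real)" for a b
  have es: "distinct es" "set es = parcs G"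
    using assms(4) by (auto simp: arc_enumeration_def)
  have supp: "positive_support (transition_mat G es) =
      mat ?n ?n (\<lambda>(i, j). S (es ! i) (es ! j))"
    by (rule eq_matI) (auto simp: positive_support_def transition_mat_def S_def)
  have dim: "transition_mat G es ^\<^sub>m 2 \<in> carrier_mat ?n ?n"
    "positive_support (transition_mat G es) ^\<^sub>m 2 \<in> carrier_mat ?n ?n"
    by (auto intro!: pow_carrier_mat simp: transition_mat_def positive_support_def)
  define p where "p = 2 / real k"
  \<comment> \<open>The bound \<open>p < 1\<close> is where \<open>k > 2\<close> enters: it makes
    \<open>p - 1\<close> negative.\<close>
  have p: "p > 0" "p < 1"
    using assms(3) by (auto simp: p_def field_simps)
  have U: "?U (w, x) (u, v) = (if v = w then if u = x then p - 1 else p else 0)"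
    if "(w, x) \<in> parcs G" for w x u v
    using transition_entry_regular[OF assms(1,2) that] by (simp add: p_def)
  show ?thesis
  proof (rule eq_matI)
    fix i j
    assume "i < dim_row (positive_support (transition_mat G es) ^\<^sub>m 2 + 1\<^sub>m ?n)"
      and "j < dim_col (positive_support (transition_mat G es) ^\<^sub>m 2 + 1\<^sub>m ?n)"
    then have ij: "i < ?n" "j < ?n"
      by simp_all
    obtain w x u v where ends: "es ! i = (w, x)" "es ! j = (u, v)"
      by (metis surj_pair)
    have arcs: "(w, x) \<in> parcs G" "(u, v) \<in> parcs G"
      using ij es(2) ends nth_mem by metis+
    have eq: "i = j \<longleftrightarrow> w = u \<and> x = v"
      using nth_eq_iff_index_eq[OF es(1) ij] ends by simp
    have "(transition_mat G es ^\<^sub>m 2) $$ (i, j) =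
        (if (v, w) \<in> parcs G then ?U (w, x) (v, w) * ?U (v, w) (u, v) else 0)"
      unfolding transition_mat_def index_mat_pow_2[OF es(1) ij] ends es(2)
      by (rule sum_two_step_walks) auto
    moreover have "(positive_support (transition_mat G es) ^\<^sub>m 2) $$ (i, j) =
        (if (v, w) \<in> parcs G then S (w, x) (v, w) * S (v, w) (u, v) else 0)"
      unfolding supp index_mat_pow_2[OF es(1) ij] ends es(2)
      by (rule sum_two_step_walks) (auto simp: S_def)
    \<comment> \<open>On the diagonal the middle arc is the reverse of \<open>(w, x)\<close>, so
      symmetry keeps the entry out of the default case 0.\<close>
    moreover have "(v, w) \<in> parcs G" if "w = u" "x = v"
      using arcs(1) that arcs_symmetric by blast
    moreover have "positive_support (transition_mat G es ^\<^sub>m 2) $$ (i, j) =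
        (if (transition_mat G es ^\<^sub>m 2) $$ (i, j) > 0 then 1 else 0)"
      using ij carrier_matD[OF dim(1)] by (simp add: positive_support_def)
    ultimately show "positive_support (transition_mat G es ^\<^sub>m 2) $$ (i, j) =
        (positive_support (transition_mat G es) ^\<^sub>m 2 + 1\<^sub>m ?n) $$ (i, j)"
      \<comment> \<open>The steps backtrack iff \<open>v = x\<close> and iff \<open>u = w\<close>,
        respectively; by \<open>eq\<close>, both do iff \<open>i = j\<close>. The product is
        \<open>p * p\<close>, \<open>p * (p - 1)\<close> or \<open>(p - 1) * (p - 1)\<close>, and
        only the mixed one is negative.\<close>
      using ij carrier_matD[OF dim(2)] p eq arcs(1)
      by (auto simp: S_def U zero_less_mult_iff simp del: transition_entry.simps)
  qed (use carrier_matD[OF dim(1)] in \<open>auto simp: positive_support_def\<close>)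
qed

end
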